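(* Without loss of generality, suppose $r_1\le r_2\le\cdots\le r_N$ and $\delta_1\le\delta_2\le\cdots\le\delta_I$. For any $\gamma\ge0$, the worst-case unmeasured confounder $\mathbf{u}^+$ for a sign-score test statistic is equal to the $N$-dimensional binary vector whose first $N_{\cdot1}$ elements are zeros and whose remaining $N_{\cdot2}=N-N_{\cdot1}$ elements are ones, i.e. $$\mathbf{u}^+=(\underbrace{0,\dots,0}_{N_{\cdot1}},\underbrace{1,\dots,1}_{N_{\cdot2}}).$$
   Context: There are $N$ subjects, $I$ treatment levels and a binary outcome ($J=2$ levels), and positive integers $N_{1\cdot},\dots,N_{I\cdot}$ with $\sum_i N_{i\cdot}=N$. Let $\mathcal{Z}(\mathbf{N}_{I\cdot})=\{\mathbf{z}\in\{1,\dots,I\}^N:\ |\{s:z_s=i\}|=N_{i\cdot}\ \forall i\}$. The outcome vector $\mathbf{r}=(r_1,\dots,r_N)\in\{1,2\}^N$ is fixed (sharp null hypothesis of no treatment effect), and $N_{\cdot j}=|\{s:r_s=j\}|$. For $\mathbf{z}\in\mathcal{Z}(\mathbf{N}_{I\cdot})$, $\mathbf{N}(\mathbf{z},\mathbf{r})$ is the $I\times 2$ table with entries $N_{ij}=\sum_{s=1}^N\mathbb{1}\{z_s=i,r_s=j\}$. A sign-score test statistic is a function of the table of the form $T(\mathbf{N})=\sum_{i=1}^I w_iN_{i2}$ for some fixed weights $w_1\le\cdots\le w_I$. For sensitivity parameters $\gamma\ge0$ and $\boldsymbol\delta=(\delta_1,\dots,\delta_I)\in\{0,1\}^I$ (not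 all entries equal), threshold $c\in\mathbb{R}$, and $\mathbf{u}\in[0,1]^N$ (unmeasured confounder), $$\alpha(T,\mathbf{r},\mathbf{u})=\frac{\sum_{\mathbf{z}\in\mathcal{Z}(\mathbf{N}_{I\cdot})}\mathbb{1}\{T(\mathbf{N}(\mathbf{z},\mathbf{r}))\ge c\}\exp\{\gamma\sum_{s=1}^N\delta_{z_s}u_s\}}{\sum_{\mathbf{b}\in\mathcal{Z}(\mathbf{N}_{I\cdot})}\exp\{\gamma\sum_{s=1}^N\delta_{b_s}u_s\}}.$$ The worst-case unmeasured confounder is defined as $\mathbf{u}^+=\operatorname{argmax}_{\mathbf{u}\in[0,1]^N}\alpha(T,\mathbf{r},\mathbf{u})$. *)

theory Defs
  imports Complex_Main "HOL-Library.FuncSet"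
begin

text \<open>
  Subjects, treatment levels and outcome levels are numbered from 1. Vectors over the subjects
  \<open>{1..N}\<close> that are summed or maximised over are extensional functions, so that each vector
  has exactly one representative.
\<close>

definition assignments :: "nat \<Rightarrow> nat \<Rightarrow> (nat \<Rightarrow> nat) \<Rightarrow> (nat \<Rightarrow> nat) set" where
  "assignments N I n =
     {z \<in> {1..N} \<rightarrow>\<^sub>E {1..I}. \<forall>i\<in>{1..I}. card {s \<in> {1..N}. z s = i} = n i}"

definition confounders :: "nat \<Rightarrow> (nat \<Rightarrow> real) set" where
  "confounders N = {1..N} \<rightarrow>\<^sub>E {0..1}"

definition outcome_count :: "nat \<Rightarrow> (nat \<Rightarrow> nat) \<Rightarrow> nat \<Rightarrow> nat" where
  "outcome_count N r j = card {s \<in> {1..N}. r s = j}"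

definition contingency_table ::
  "nat \<Rightarrow> (nat \<Rightarrow> nat) \<Rightarrow> (nat \<Rightarrow> nat) \<Rightarrow> nat \<Rightarrow> nat \<Rightarrow> nat" where
  "contingency_table N z r i j = (\<Sum>s=1..N. of_bool (z s = i \<and> r s = j))"

text \<open>The monotonicity of the weights \<open>w\<close> is assumed where the statistic is used.\<close>

definition sign_score :: "nat \<Rightarrow> (nat \<Rightarrow> real) \<Rightarrow> (nat \<Rightarrow> nat \<Rightarrow> nat) \<Rightarrow> real" where
  "sign_score I w tab = (\<Sum>i=1..I. w i * real (tab i 2))"

text \<open>
  The significance level of the test that rejects when \<open>T \<ge> c\<close>, for fixed outcomes \<open>r\<close>,
  margins \<open>n\<close>, sensitivity parameters \<open>\<gamma>\<close>, \<open>\<delta>\<close> and confounder \<open>u\<close>.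
\<close>

definition significance ::
  "nat \<Rightarrow> nat \<Rightarrow> (nat \<Rightarrow> nat) \<Rightarrow> real \<Rightarrow> (nat \<Rightarrow> real) \<Rightarrow> real \<Rightarrow>
   ((nat \<Rightarrow> nat \<Rightarrow> nat) \<Rightarrow> real) \<Rightarrow> (nat \<Rightarrow> nat) \<Rightarrow> (nat \<Rightarrow> real) \<Rightarrow> real" where
  "significance N I n \<gamma> \<delta> c T r u =
     (\<Sum>z\<in>assignments N I n.
        of_bool (T (contingency_table N z r) \<ge> c) * exp (\<gamma> * (\<Sum>s=1..N. \<delta> (z s) * u s))) /
     (\<Sum>b\<in>assignments N I n. exp (\<gamma> * (\<Sum>s=1..N. \<delta> (b s) * u s)))"

text \<open>
  A maximiser need not be unique (the level does not depend on \<open>u\<close> when \<open>\<gamma> = 0\<close>), so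
  being a worst-case confounder is a predicate.
\<close>

definition worst_case_confounder ::
  "nat \<Rightarrow> nat \<Rightarrow> (nat \<Rightarrow> nat) \<Rightarrow> real \<Rightarrow> (nat \<Rightarrow> real) \<Rightarrow> real \<Rightarrow>
   ((nat \<Rightarrow> nat \<Rightarrow> nat) \<Rightarrow> real) \<Rightarrow> (nat \<Rightarrow> nat) \<Rightarrow> (nat \<Rightarrow> real) \<Rightarrow> bool" where
  "worst_case_confounder N I n \<gamma> \<delta> c T r u \<longleftrightarrow>
     is_arg_max (significance N I n \<gamma> \<delta> c T r) (\<lambda>v. v \<in> confounders N) u"

end

theory Submission
  imports Defs "HOL-Combinatorics.Permutations"
begin

text \<open>
  Let \<open>D z\<close> be the set of subjects with \<open>\<delta> (z s) = 1\<close>; its size \<open>m\<close> is fixed by the margins. Let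
  \<open>S\<close> be the set of subjects with outcome 2. The exponential weight of \<open>z\<close> depends only on \<open>D z\<close>,
  so the significance level is the expectation of \<open>F\<close> under a weight on the \<open>m\<close>-subsets \<open>D\<close>, where
  \<open>F D\<close> is the number of rejecting assignments with \<open>D z = D\<close>, up to a constant factor. Exchanging
  the treatments of some \<open>l \<in> D\<close> and \<open>k \<notin> D\<close> does not decrease the statistic unless \<open>l \<in> S\<close> and
  \<open>k \<notin> S\<close>; hence \<open>F D\<close> is an increasing function of the overlap \<open>card (D \<inter> S)\<close>.

  The claimed maximiser gives \<open>D\<close> the weight \<open>b D = exp (\<gamma> * card (D \<inter> S))\<close>, and any other confounder
  \<open>u\<close> gives it \<open>b D * \<phi> D\<close>, where \<open>\<phi>\<close> does not increase when an element outside \<open>S\<close> is replaced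
  by one in \<open>S\<close>, because \<open>0 \<le> u \<le> 1\<close>. As \<open>F\<close> and \<open>b\<close> are invariant under the permutations that
  fix \<open>S\<close> setwise, \<open>\<phi>\<close> may be replaced by its average over them, which is a decreasing function of
  the overlap. The comparison of the two levels is then Chebyshev's sum inequality.
\<close>

section \<open>Exchanges between sets of equal size\<close>

text \<open>Admissible exchanges lead from \<open>D\<close> to \<open>D'\<close>, by induction on
  the size of \<open>D - D'\<close>. For \<open>S = {}\<close> every exchange is admissible and all
  overlaps are 0, so \<open>h\<close> then compares in both directions.\<close>

lemma overlap_mono:
  fixes h :: "'a set \<Rightarrow> 'b::preorder"
  assumes "finite A"
    and step: "\<And>D k l. D \<subseteq> A \<Longrightarrow> card D = m \<Longrightarrow> l \<in> D \<Longrightarrow> k \<in> A - D \<Longrightarrow> (l \<in> S \<Longrightarrow> k \<in> S) \<Longrightarrow>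
            h D \<le> h (insert k (D - {l}))"
    and "D \<subseteq> A" "card D = m" "D' \<subseteq> A" "card D' = m"
    and "card (D \<inter> S) \<le> card (D' \<inter> S)"
  shows "h D \<le> h D'"
  using assms(3,4,7)
proof (induction "card (D - D')" arbitrary: D rule: less_induct)
  case less
  have fin: "finite D" "finite D'"
    using less.prems assms(1,5) finite_subset by blast+
  show ?case
  proof (cases "D = D'")
    case False
    have "\<not> D \<subseteq> D'" "\<not> D' \<subseteq> D"
      using False fin less.prems assms(6) by (metis card_subset_eq)+
    \<comment> \<open>If \<open>D \<inter> S\<close> lies inside \<open>D'\<close>, then
      \<open>D - D'\<close> avoids \<open>S\<close> and any pair works. Otherwise the comparison of
      overlaps provides elements of \<open>S\<close> in both differences, and the pair is taken from
      \<open>S\<close>.\<close>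
    have "\<exists>l\<in>D - D'. \<exists>k\<in>D' - D. (l \<in> S \<longrightarrow> k \<in> S) \<and> (k \<in> S \<longrightarrow> l \<in> S \<or> D \<inter> S \<subseteq> D' \<inter> S)"
    proof (cases "D \<inter> S \<subseteq> D' \<inter> S")
      case True
      then show ?thesis using \<open>\<not> D \<subseteq> D'\<close> \<open>\<not> D' \<subseteq> D\<close> by blast
    next
      case nsub: False
      have "\<not> D' \<inter> S \<subseteq> D \<inter> S"
      proof
        assume "D' \<inter> S \<subseteq> D \<inter> S"
        then have "D' \<inter> S = D \<inter> S"
          using less.prems(3) fin by (intro card_seteq) auto
        with nsub show False by simp
      qed
      with nsub show ?thesis by blast
    qed
    then obtain l k where l: "l \<in> D" "l \<notin> D'" and k: "k \<in> D'" "k \<notin> D"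
      and lk: "l \<in> S \<Longrightarrow> k \<in> S" and kl: "k \<in> S \<Longrightarrow> l \<in> S \<or> D \<inter> S \<subseteq> D' \<inter> S"
      by blast
    \<comment> \<open>An exchange that keeps the overlap with \<open>S\<close> at most that of \<open>D'\<close> and brings \<open>D\<close> closer to \<open>D'\<close>.\<close>
    define E where "E = insert k (D - {l})"
    have "k \<in> A" using k assms(5) by blast
    have swap: "card (insert k (B - {l})) = card B" if "finite B" "l \<in> B" "k \<notin> B" for B
      using that card_Suc_Diff1[OF that(1,2)] by (simp del: card_Diff_insert card_Diff_singleton)
    have E: "E \<subseteq> A" "card E = m"
      using less.prems l k \<open>k \<in> A\<close> fin swap[of D] by (auto simp: E_def)
    have "E - D' \<subset> D - D'" using k l by (auto simp: E_def)
    then have "card (E - D') < card (D - D')"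
      using fin by (intro psubset_card_mono) auto
    moreover have "card (E \<inter> S) \<le> card (D' \<inter> S)"
    proof (cases "k \<in> S \<and> l \<notin> S")
      case True
      then have "E \<inter> S \<subseteq> D' \<inter> S" using kl k by (auto simp: E_def)
      then show ?thesis using fin by (intro card_mono) auto
    next
      case False
      then have "card (E \<inter> S) = card (D \<inter> S)"
      proof (cases "l \<in> S")
        case True
        then have "E \<inter> S = insert k (D \<inter> S - {l})" using lk by (auto simp: E_def)
        then show ?thesis using True l k fin swap[of "D \<inter> S"] by simp
      next
        case nl: False
        then have "E \<inter> S = D \<inter> S" using False by (auto simp: E_def)
        then show ?thesis by simp
      qed
      then show ?thesis using less.prems by simp
    qed
    ultimately have "h E \<le> h D'" using less.hyps E by blast
    moreover have "h D \<le> h E"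
      unfolding E_def using step less.prems l k \<open>k \<in> A\<close> lk by blast
    ultimately show ?thesis using order_trans by blast
  qed simp
qed

section \<open>Chebyshev's sum inequality\<close>

text \<open>The double sum of \<open>b x * b y * ((f x - f y) * (g x - g y))\<close> is nonpositive
  and expands to twice the difference of the two sides.\<close>

lemma chebyshev_sum_weighted:
  fixes b f g :: "'a \<Rightarrow> real"
  assumes "\<And>x. x \<in> X \<Longrightarrow> b x \<ge> 0"
    and "\<And>x y. x \<in> X \<Longrightarrow> y \<in> X \<Longrightarrow> (f x - f y) * (g x - g y) \<le> 0"
  shows "(\<Sum>x\<in>X. b x * f x * g x) * (\<Sum>x\<in>X. b x) \<le> (\<Sum>x\<in>X. b x * f x) * (\<Sum>x\<in>X. b x * g x)"
proof -
  have "(\<Sum>x\<in>X. \<Sum>y\<in>X. b x * b y * ((f x - f y) * (g x - g y))) \<le> 0"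
    using assms by (intro sum_nonpos mult_nonneg_nonpos[OF mult_nonneg_nonneg])
  also have "(\<Sum>x\<in>X. \<Sum>y\<in>X. b x * b y * ((f x - f y) * (g x - g y))) =
     (\<Sum>x\<in>X. \<Sum>y\<in>X. b x * f x * g x * b y) + (\<Sum>x\<in>X. \<Sum>y\<in>X. b x * (b y * f y * g y))
     - (\<Sum>x\<in>X. \<Sum>y\<in>X. b x * f x * (b y * g y)) - (\<Sum>x\<in>X. \<Sum>y\<in>X. b x * g x * (b y * f y))"
    by (simp add: sum.distrib[symmetric] sum_subtractf[symmetric] algebra_simps)
  also have "\<dots> = 2 * ((\<Sum>x\<in>X. b x * f x * g x) * (\<Sum>x\<in>X. b x))
      - 2 * ((\<Sum>x\<in>X. b x * f x) * (\<Sum>x\<in>X. b x * g x))"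
    unfolding sum_product[symmetric] by (simp add: algebra_simps)
  finally show ?thesis by simp
qed

section \<open>Averaging over the permutations that preserve \<open>S\<close>\<close>

definition setwise_stabilizer :: "'a set \<Rightarrow> 'a set \<Rightarrow> ('a \<Rightarrow> 'a) set" where
  "setwise_stabilizer A S = {p. p permutes A \<and> p ` S = S}"

lemma card_image_Int_stabilizer:
  assumes "p \<in> setwise_stabilizer A S"
  shows "card (p ` D \<inter> S) = card (D \<inter> S)"
proof -
  have p: "inj p" "p ` S = S"
    using assms permutes_inj by (auto simp: setwise_stabilizer_def)
  have "p ` D \<inter> S = p ` (D \<inter> S)"
    using image_Int[OF p(1), of D S] p(2) by simp
  then show ?thesis
    using p(1) by (simp add: card_image inj_on_subset)
qed

lemma bij_betw_image_card_subsets: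
  assumes "p permutes A"
  shows "bij_betw ((`) p) {D. D \<subseteq> A \<and> card D = m} {D. D \<subseteq> A \<and> card D = m}"
proof (rule bij_betw_byWitness[where f' = "(`) (inv p)"])
  have inj: "inj p" "inj (inv p)"
    using assms permutes_inj permutes_inv by blast+
  show "\<forall>D\<in>{D. D \<subseteq> A \<and> card D = m}. inv p ` p ` D = D"
    using inj(1) by (simp add: image_image)
  show "\<forall>D\<in>{D. D \<subseteq> A \<and> card D = m}. p ` inv p ` D = D"
    using assms by (simp add: image_image permutes_inverses)
  show "(`) p ` {D. D \<subseteq> A \<and> card D = m} \<subseteq> {D. D \<subseteq> A \<and> card D = m}"
    using assms inj permutes_in_image[OF assms]
    by (auto simp: card_image inj_on_subset)
  show "(`) (inv p) ` {D. D \<subseteq> A \<and> card D = m} \<subseteq> {D. D \<subseteq> A \<and> card D = m}"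
    using assms inj permutes_in_image[OF permutes_inv[OF assms]]
    by (auto simp: card_image inj_on_subset)
qed

text \<open>The hypothesis controls only exchanges that move an element into \<open>S\<close>. These
  are compared term by term, since each \<open>p\<close> carries such an exchange to another one. An
  exchange that stays inside or outside \<open>S\<close> is a transposition in the stabilizer and
  leaves the orbit sum unchanged.\<close>

lemma orbit_sum_antimono_overlap:
  fixes \<phi> :: "'a set \<Rightarrow> real"
  assumes "finite A"
    and step: "\<And>D k l. D \<subseteq> A \<Longrightarrow> card D = m \<Longrightarrow> l \<in> D - S \<Longrightarrow> k \<in> S - D \<Longrightarrow>
            \<phi> (insert k (D - {l})) \<le> \<phi> D"
    and "D \<subseteq> A" "card D = m" "D' \<subseteq> A" "card D' = m"
    and "card (D \<inter> S) \<le> card (D' \<inter> S)"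
  shows "(\<Sum>p\<in>setwise_stabilizer A S. \<phi> (p ` D')) \<le> (\<Sum>p\<in>setwise_stabilizer A S. \<phi> (p ` D))"
proof -
  let ?G = "setwise_stabilizer A S"
  \<comment> \<open>Negation turns the claim into the increasing form of
    \<open>overlap_mono\<close>.\<close>
  have "- (\<Sum>p\<in>?G. \<phi> (p ` D)) \<le> - (\<Sum>p\<in>?G. \<phi> (p ` D'))"
  proof (rule overlap_mono[OF assms(1) _ assms(3-7)])
    fix D k l
    assume D: "D \<subseteq> A" "card D = m" and l: "l \<in> D" and k: "k \<in> A - D" and lk: "l \<in> S \<Longrightarrow> k \<in> S"
    let ?E = "insert k (D - {l})"
    have "(\<Sum>p\<in>?G. \<phi> (p ` ?E)) \<le> (\<Sum>p\<in>?G. \<phi> (p ` D))"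
    proof (cases "k \<in> S \<and> l \<notin> S")
      case True
      show ?thesis
      proof (rule sum_mono)
        fix p assume p: "p \<in> ?G"
        then have pA: "p permutes A" and pS: "p ` S = S" and "inj p"
          using permutes_inj by (auto simp: setwise_stabilizer_def)
        have mem: "p s \<in> S \<longleftrightarrow> s \<in> S" for s
          using pS \<open>inj p\<close> by (metis inj_image_mem_iff)
        have "p ` D \<in> {D. D \<subseteq> A \<and> card D = m}"
          using bij_betw_apply[OF bij_betw_image_card_subsets[OF pA]] D by blast
        moreover have "p ` ?E = insert (p k) (p ` D - {p l})"
          using \<open>inj p\<close> by (simp add: image_set_diff)
        ultimately show "\<phi> (p ` ?E) \<le> \<phi> (p ` D)"
          using step[of "p ` D" "p l" "p k"] True l k mem \<open>inj p\<close>
          by (auto simp: inj_image_mem_iff)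
      qed
    next
      case False
      define t where "t = transpose k l"
      have same: "k \<in> S \<longleftrightarrow> l \<in> S" using False lk by blast
      have t: "t permutes A"
        unfolding t_def using l k D by (intro permutes_swap_id) auto
      have tt: "t \<circ> t = id" by (auto simp: t_def fun_eq_iff)
      have tS: "t ` S = S"
      proof -
        have "t ` S \<subseteq> S" using same by (auto simp: t_def transpose_def)
        \<comment> \<open>As \<open>t\<close> is an involution, applying it to the inclusion yields
          the reverse one.\<close>
        moreover from this have "t ` t ` S \<subseteq> t ` S" by blast
        ultimately show ?thesis using tt by (simp add: image_comp)
      qed
      have tD: "t ` D = ?E"
        using l k by (auto simp: t_def transpose_def image_iff)
      have G: "p \<circ> t \<in> ?G" if "p \<in> ?G" for p
        using that permutes_compose[OF t, of p] tS image_comp[of p t S]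
        by (simp add: setwise_stabilizer_def del: image_comp)
      have "(\<Sum>p\<in>?G. \<phi> (p ` ?E)) = (\<Sum>p\<in>?G. \<phi> (p ` D))"
        \<comment> \<open>Right composition with \<open>t\<close> is an involution of the stabilizer
          and interchanges the images of \<open>D\<close> and \<open>?E\<close>.\<close>
        by (rule sum.reindex_bij_witness[where i = "\<lambda>p. p \<circ> t" and j = "\<lambda>p. p \<circ> t"])
          (simp_all only: G comp_assoc tt comp_id image_comp[symmetric] tD)
      then show ?thesis by simp
    qed
    then show "- (\<Sum>p\<in>?G. \<phi> (p ` D)) \<le> - (\<Sum>p\<in>?G. \<phi> (p ` ?E))" by simp
  qed
  then show ?thesis by simp
qed

text \<open>Since \<open>b\<close> and \<open>F\<close> are constant on orbits, \<phi> may be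
  replaced by its orbit sum \<psi> in both sums at the cost of a common factor, the order of the
  group. Unlike \<phi>, \<psi> is ordered oppositely to \<open>F\<close> on all of \<open>X\<close>,
  as Chebyshev's inequality requires.\<close>

lemma overlap_association:
  fixes F \<phi> b :: "'a set \<Rightarrow> real" and A S :: "'a set" and m :: nat
  assumes "finite A"
  defines "X \<equiv> {D. D \<subseteq> A \<and> card D = m}"
  assumes F: "\<And>D D'. D \<in> X \<Longrightarrow> D' \<in> X \<Longrightarrow> card (D \<inter> S) \<le> card (D' \<inter> S) \<Longrightarrow> F D \<le> F D'"
    and \<phi>: "\<And>D k l. D \<in> X \<Longrightarrow> l \<in> D - S \<Longrightarrow> k \<in> S - D \<Longrightarrow> \<phi> (insert k (D - {l})) \<le> \<phi> D"
    and b: "\<And>D. b D = \<beta> (card (D \<inter> S))" "\<And>D. b D \<ge> 0"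
  shows "(\<Sum>D\<in>X. b D * F D * \<phi> D) * (\<Sum>D\<in>X. b D) \<le> (\<Sum>D\<in>X. b D * F D) * (\<Sum>D\<in>X. b D * \<phi> D)"
proof -
  let ?G = "setwise_stabilizer A S"
  define \<psi> where "\<psi> D = (\<Sum>p\<in>?G. \<phi> (p ` D))" for D
  have "finite ?G"
    using finite_permutations[OF assms(1)] by (auto simp: setwise_stabilizer_def intro: finite_subset)
  moreover have "id \<in> ?G" by (simp add: setwise_stabilizer_def)
  ultimately have G: "card ?G > 0" by (auto simp: card_gt_0_iff)
  have average: "(\<Sum>D\<in>X. g D * \<psi> D) = card ?G * (\<Sum>D\<in>X. g D * \<phi> D)"
    if g: "\<And>D p. p \<in> ?G \<Longrightarrow> D \<in> X \<Longrightarrow> g (p ` D) = g D" for g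
  proof -
    have "(\<Sum>D\<in>X. g D * \<psi> D) = (\<Sum>p\<in>?G. \<Sum>D\<in>X. g D * \<phi> (p ` D))"
      unfolding \<psi>_def sum_distrib_left by (rule sum.swap)
    also have "\<dots> = (\<Sum>p\<in>?G. \<Sum>D\<in>X. g D * \<phi> D)"
    proof (rule sum.cong[OF refl])
      fix p assume p: "p \<in> ?G"
      then have bij: "bij_betw ((`) p) X X"
        unfolding X_def by (intro bij_betw_image_card_subsets) (simp add: setwise_stabilizer_def)
      have "(\<Sum>D\<in>X. g D * \<phi> (p ` D)) = (\<Sum>D\<in>X. g (p ` D) * \<phi> (p ` D))"
        using g p by simp
      also have "\<dots> = (\<Sum>D\<in>X. g D * \<phi> D)"
        by (rule sum.reindex_bij_betw[OF bij])
      finally show "(\<Sum>D\<in>X. g D * \<phi> (p ` D)) = (\<Sum>D\<in>X. g D * \<phi> D)" .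
    qed
    finally show ?thesis by simp
  qed
  have X_image: "p ` D \<in> X" if "p \<in> ?G" "D \<in> X" for p D
    using that bij_betw_apply[OF bij_betw_image_card_subsets[of p A m]]
    unfolding X_def setwise_stabilizer_def by blast
  have b_inv: "b (p ` D) = b D" if "p \<in> ?G" for p D
    using that by (simp add: b(1) card_image_Int_stabilizer)
  have F_inv: "F (p ` D) = F D" if "p \<in> ?G" "D \<in> X" for p D
    using that X_image by (intro antisym F) (auto simp: card_image_Int_stabilizer)
  have \<psi>_anti: "\<psi> D' \<le> \<psi> D" if "D \<in> X" "D' \<in> X" "card (D \<inter> S) \<le> card (D' \<inter> S)" for D D'
    unfolding \<psi>_def using that \<phi>
    by (intro orbit_sum_antimono_overlap[OF assms(1)]) (auto simp: X_def)
  have "(F D - F D') * (\<psi> D - \<psi> D') \<le> 0" if "D \<in> X" "D' \<in> X" for D D'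
    using F[of D D'] F[of D' D] \<psi>_anti[of D D'] \<psi>_anti[of D' D] that
    by (cases "card (D \<inter> S) \<le> card (D' \<inter> S)") (auto simp: mult_le_0_iff)
  then have "(\<Sum>D\<in>X. b D * F D * \<psi> D) * (\<Sum>D\<in>X. b D) \<le> (\<Sum>D\<in>X. b D * F D) * (\<Sum>D\<in>X. b D * \<psi> D)"
    by (intro chebyshev_sum_weighted) (auto simp: b(2))
  then show ?thesis
    using G by (simp add: average b_inv F_inv)
qed

section \<open>Assignments grouped by exposed set\<close>

definition exposed :: "nat \<Rightarrow> (nat \<Rightarrow> real) \<Rightarrow> (nat \<Rightarrow> nat) \<Rightarrow> nat set" where
  "exposed N \<delta> z = {s \<in> {1..N}. \<delta> (z s) = 1}"

lemma finite_assignments [simp]: "finite (assignments N I n)"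
  unfolding assignments_def by (rule finite_subset[of _ "{1..N} \<rightarrow>\<^sub>E {1..I}"]) (blast, simp add: finite_PiE)

lemma assignments_comp_permutes:
  assumes p: "p permutes {1..N}" and z: "z \<in> assignments N I n"
  shows "z \<circ> p \<in> assignments N I n"
proof -
  have zI: "z \<in> {1..N} \<rightarrow>\<^sub>E {1..I}" using z by (simp add: assignments_def)
  \<comment> \<open>Extensionality survives because \<open>p\<close> fixes every point outside
    \<open>{1..N}\<close>.\<close>
  have "z \<circ> p \<in> {1..N} \<rightarrow>\<^sub>E {1..I}"
    using zI permutes_in_image[OF p] permutes_not_in[OF p]
    by (auto simp: PiE_iff extensional_def)
  moreover have "card {s \<in> {1..N}. (z \<circ> p) s = i} = card {s \<in> {1..N}. z s = i}" for i
  proof -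
    have "p ` {s \<in> {1..N}. (z \<circ> p) s = i} = {s \<in> {1..N}. z s = i}"
    proof
      show "{s \<in> {1..N}. z s = i} \<subseteq> p ` {s \<in> {1..N}. (z \<circ> p) s = i}"
      proof
        fix s assume "s \<in> {s \<in> {1..N}. z s = i}"
        then have "inv p s \<in> {s \<in> {1..N}. (z \<circ> p) s = i}"
          using permutes_in_image[OF permutes_inv[OF p], of s] permutes_inverses[OF p] by auto
        then show "s \<in> p ` {s \<in> {1..N}. (z \<circ> p) s = i}"
          using permutes_inverses[OF p] by (metis imageI)
      qed
    qed (use permutes_in_image[OF p] in auto)
    then show ?thesis
      using card_image[OF permutes_inj_on[OF p], of "{s \<in> {1..N}. (z \<circ> p) s = i}"] by simp
  qed
  ultimately show ?thesis using z by (simp add: assignments_def)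
qed

lemma exposed_comp_transpose:
  assumes "k \<in> {1..N}" "l \<in> {1..N}" "l \<in> exposed N \<delta> z" "k \<notin> exposed N \<delta> z"
  shows "exposed N \<delta> (z \<circ> transpose k l) = insert k (exposed N \<delta> z - {l})"
proof (rule set_eqI)
  fix s
  show "s \<in> exposed N \<delta> (z \<circ> transpose k l) \<longleftrightarrow> s \<in> insert k (exposed N \<delta> z - {l})"
    using assms by (cases "s = k"; cases "s = l") (auto simp: exposed_def)
qed

lemma card_exposed:
  assumes "z \<in> assignments N I n"
  shows "card (exposed N \<delta> z) = (\<Sum>i | i \<in> {1..I} \<and> \<delta> i = 1. n i)"
proof -
  have zI: "z s \<in> {1..I}" if "s \<in> {1..N}" for s
    using assms that by (auto simp: assignments_def)
  have "exposed N \<delta> z = (\<Union>i\<in>{i\<in>{1..I}. \<delta> i = 1}. {s \<in> {1..N}. z s = i})"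
    using zI by (auto simp: exposed_def)
  also have "card \<dots> = (\<Sum>i\<in>{i\<in>{1..I}. \<delta> i = 1}. card {s \<in> {1..N}. z s = i})"
    by (rule card_UN_disjoint) auto
  also have "\<dots> = (\<Sum>i | i \<in> {1..I} \<and> \<delta> i = 1. n i)"
    using assms by (intro sum.cong) (auto simp: assignments_def)
  finally show ?thesis .
qed

text \<open>Composition with the transposition of \<open>k\<close> and \<open>l\<close> injects the
  rejecting assignments exposing \<open>D\<close> into those exposing the exchanged set.\<close>

lemma card_assignments_exposed_mono:
  fixes T :: "(nat \<Rightarrow> nat) \<Rightarrow> real" and N m :: nat
  defines "X \<equiv> {D. D \<subseteq> {1..N} \<and> card D = m}"
  assumes T: "\<And>z k l. z \<in> assignments N I n \<Longrightarrow> l \<in> exposed N \<delta> z \<Longrightarrow> k \<in> {1..N} - exposed N \<delta> z \<Longrightarrow>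
              (l \<in> S \<Longrightarrow> k \<in> S) \<Longrightarrow> T z \<le> T (z \<circ> transpose k l)"
    and "D \<in> X" "D' \<in> X" "card (D \<inter> S) \<le> card (D' \<inter> S)"
  shows "card {z \<in> assignments N I n. exposed N \<delta> z = D \<and> T z \<ge> c}
       \<le> card {z \<in> assignments N I n. exposed N \<delta> z = D' \<and> T z \<ge> c}"
proof (rule overlap_mono[where A = "{1..N}" and m = m and S = S])
  fix D k l
  assume D: "D \<subseteq> {1..N}" "card D = m" and l: "l \<in> D" and k: "k \<in> {1..N} - D" and lk: "l \<in> S \<Longrightarrow> k \<in> S"
  let ?t = "transpose k l"
  have t: "?t permutes {1..N}" using D l k by (intro permutes_swap_id) auto
  show "card {z \<in> assignments N I n. exposed N \<delta> z = D \<and> T z \<ge> c}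
      \<le> card {z \<in> assignments N I n. exposed N \<delta> z = insert k (D - {l}) \<and> T z \<ge> c}"
  proof (rule card_inj_on_le[where f = "\<lambda>z. z \<circ> ?t"])
    show "inj_on (\<lambda>z. z \<circ> ?t) {z \<in> assignments N I n. exposed N \<delta> z = D \<and> T z \<ge> c}"
      by (rule inj_on_inverseI[where g = "\<lambda>z. z \<circ> ?t"]) (simp add: comp_assoc)
    show "(\<lambda>z. z \<circ> ?t) ` {z \<in> assignments N I n. exposed N \<delta> z = D \<and> T z \<ge> c}
        \<subseteq> {z \<in> assignments N I n. exposed N \<delta> z = insert k (D - {l}) \<and> T z \<ge> c}"
    proof (rule image_subsetI, simp, elim conjE)
      fix z assume z: "z \<in> assignments N I n" "exposed N \<delta> z = D" "c \<le> T z"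
      have "c \<le> T (z \<circ> ?t)" using T[OF z(1), of l k] l k lk z by fastforce
      moreover have "exposed N \<delta> (z \<circ> ?t) = insert k (D - {l})"
        using l k z D exposed_comp_transpose[of k N l \<delta> z] by auto
      ultimately show "z \<circ> ?t \<in> assignments N I n \<and>
          exposed N \<delta> (z \<circ> ?t) = insert k (D - {l}) \<and> c \<le> T (z \<circ> ?t)"
        using assignments_comp_permutes[OF t z(1)] by blast
    qed
  qed simp
qed (use assms in \<open>auto simp: X_def\<close>)

text \<open>As \<delta> is 0 or 1, the exponent is \<gamma> times the sum of \<open>v\<close> over
  the exposed set. The predicate \<open>P\<close> is left general to cover both the numerator and
  the denominator of the level.\<close>

lemma sum_assignments_exposed:
  assumes \<delta>: "\<delta> \<in> {1..I} \<rightarrow> {0, 1}"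
  shows "(\<Sum>z\<in>assignments N I n. of_bool (P z) * exp (\<gamma> * (\<Sum>s=1..N. \<delta> (z s) * v s))) =
     (\<Sum>D | D \<subseteq> {1..N} \<and> card D = (\<Sum>i | i \<in> {1..I} \<and> \<delta> i = 1. n i).
        real (card {z \<in> assignments N I n. exposed N \<delta> z = D \<and> P z}) * exp (\<gamma> * sum v D))"
    (is "?lhs = sum _ ?X")
proof -
  let ?Z = "assignments N I n"
  have lin: "(\<Sum>s=1..N. \<delta> (z s) * v s) = sum v (exposed N \<delta> z)" if "z \<in> ?Z" for z
  proof -
    have "\<delta> (z s) = of_bool (\<delta> (z s) = 1)" if "s \<in> {1..N}" for s
    proof -
      have "z s \<in> {1..I}" using \<open>z \<in> ?Z\<close> that by (auto simp: assignments_def)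
      then show ?thesis using \<delta> by fastforce
    qed
    then have "(\<Sum>s=1..N. \<delta> (z s) * v s) = (\<Sum>s=1..N. if \<delta> (z s) = 1 then v s else 0)"
      by (intro sum.cong refl) (metis mult_1 mult_zero_left of_bool_eq(1,2))
    then show ?thesis
      by (simp only: exposed_def sum.inter_filter[OF finite_atLeastAtMost])
  qed
  have "?lhs = (\<Sum>D\<in>?X. \<Sum>z | z \<in> ?Z \<and> exposed N \<delta> z = D.
      of_bool (P z) * exp (\<gamma> * (\<Sum>s=1..N. \<delta> (z s) * v s)))"
    by (rule sum.group[symmetric]) (use card_exposed in \<open>force simp: exposed_def\<close>)+
  also have "\<dots> = (\<Sum>D\<in>?X. \<Sum>z | z \<in> ?Z \<and> exposed N \<delta> z = D. of_bool (P z) * exp (\<gamma> * sum v D))"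
    by (intro sum.cong refl) (clarsimp simp: lin simp del: One_nat_def)
  also have "\<dots> = (\<Sum>D\<in>?X. real (card {z \<in> ?Z. exposed N \<delta> z = D \<and> P z}) * exp (\<gamma> * sum v D))"
  proof (rule sum.cong[OF refl])
    fix D
    have "(\<Sum>z | z \<in> ?Z \<and> exposed N \<delta> z = D. of_bool (P z)) =
        real (card {z \<in> ?Z. exposed N \<delta> z = D \<and> P z})"
      by (simp add: sum_of_bool_eq Collect_conj_eq Int_assoc)
    then show "(\<Sum>z | z \<in> ?Z \<and> exposed N \<delta> z = D. of_bool (P z) * exp (\<gamma> * sum v D)) =
        real (card {z \<in> ?Z. exposed N \<delta> z = D \<and> P z}) * exp (\<gamma> * sum v D)"
      by (simp only: sum_distrib_right[symmetric])
  qed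
  finally show ?thesis .
qed

section \<open>The sign score under exchanges\<close>

lemma sign_score_contingency_table:
  assumes "z \<in> assignments N I n"
  shows "sign_score I w (contingency_table N z r) = (\<Sum>s | s \<in> {1..N} \<and> r s = 2. w (z s))"
proof -
  have "sign_score I w (contingency_table N z r) =
      (\<Sum>i=1..I. \<Sum>s=1..N. w i * of_bool (z s = i \<and> r s = 2))"
    by (simp only: sign_score_def contingency_table_def of_nat_sum of_nat_of_bool sum_distrib_left)
  also have "\<dots> = (\<Sum>s=1..N. \<Sum>i=1..I. w i * of_bool (z s = i \<and> r s = 2))"
    by (rule sum.swap)
  also have "\<dots> = (\<Sum>s=1..N. if r s = 2 then w (z s) else 0)"
  proof (rule sum.cong[OF refl])
    fix s assume "s \<in> {1..N}"
    then have "z s \<in> {1..I}" using assms by (auto simp: assignments_def)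
    then have "(\<Sum>i=1..I. if i = z s then (if r s = 2 then w i else 0) else 0) =
        (if r s = 2 then w (z s) else 0)"
      by (subst sum.delta) auto
    moreover have "(\<Sum>i=1..I. w i * of_bool (z s = i \<and> r s = 2)) =
        (\<Sum>i=1..I. if i = z s then (if r s = 2 then w i else 0) else 0)"
      by (intro sum.cong) auto
    ultimately show "(\<Sum>i=1..I. w i * of_bool (z s = i \<and> r s = 2)) = (if r s = 2 then w (z s) else 0)"
      by simp
  qed
  also have "\<dots> = (\<Sum>s | s \<in> {1..N} \<and> r s = 2. w (z s))"
    by (simp only: sum.inter_filter[OF finite_atLeastAtMost])
  finally show ?thesis .
qed

text \<open>The sum can change only when \<open>k\<close> alone lies in \<open>S\<close>, and then
  \<open>g k\<close> is replaced by \<open>g l\<close>.\<close>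

lemma sum_comp_transpose_mono:
  fixes g :: "'a \<Rightarrow> real"
  assumes "finite S" "l \<in> S \<Longrightarrow> k \<in> S" "g k \<le> g l"
  shows "sum g S \<le> (\<Sum>s\<in>S. g (transpose k l s))"
proof (cases "k \<in> S \<and> l \<notin> S")
  case True
  have "sum g S = g k + sum g (S - {k})"
    using True assms(1) by (simp add: sum.remove)
  also have "\<dots> \<le> g l + (\<Sum>s\<in>S - {k}. g (transpose k l s))"
    using True assms(3) by (intro add_mono[OF _ eq_refl] sum.cong) (auto simp: transpose_def)
  also have "\<dots> = (\<Sum>s\<in>S. g (transpose k l s))"
    using True assms(1) by (simp add: sum.remove[of S k])
  finally show ?thesis .
next
  case False
  show ?thesis
  proof (cases "k \<in> S")
    case True
    then have "transpose k l permutes S"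
      using False by (intro permutes_swap_id) auto
    from sum.permute[OF this, of g] show ?thesis by (simp add: comp_def)
  next
    case k: False
    then have "l \<notin> S" using assms(2) by blast
    with k show ?thesis
      by (intro eq_refl sum.cong) (auto simp: transpose_def)
  qed
qed

lemma sign_score_comp_transpose_mono:
  assumes w: "mono_on {1..I} w" and \<delta>: "\<delta> \<in> {1..I} \<rightarrow> {0, 1}" "mono_on {1..I} \<delta>"
    and z: "z \<in> assignments N I n" and l: "l \<in> exposed N \<delta> z" and k: "k \<in> {1..N} - exposed N \<delta> z"
    and lk: "l \<in> {s \<in> {1..N}. r s = 2} \<Longrightarrow> k \<in> {s \<in> {1..N}. r s = 2}"
  shows "sign_score I w (contingency_table N z r)
       \<le> sign_score I w (contingency_table N (z \<circ> transpose k l) r)"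
proof -
  have l': "l \<in> {1..N}" "\<delta> (z l) = 1" using l by (auto simp: exposed_def)
  have zI: "z k \<in> {1..I}" "z l \<in> {1..I}"
    using z k l' by (auto simp: assignments_def)
  have "\<delta> (z k) = 0" using k \<delta>(1) zI by (auto simp: exposed_def)
  then have "\<not> \<delta> (z l) \<le> \<delta> (z k)" using l' by simp
  \<comment> \<open>The common ordering of \<delta> and \<open>w\<close> enters here: the exposed
    subject has the higher treatment level and therefore at least the weight of the other.\<close>
  then have "\<not> z l \<le> z k" using mono_onD[OF \<delta>(2)] zI by blast
  then have "w (z k) \<le> w (z l)" using mono_onD[OF w] zI by simp
  then have "(\<Sum>s | s \<in> {1..N} \<and> r s = 2. w (z s)) \<le>
      (\<Sum>s | s \<in> {1..N} \<and> r s = 2. w (z (transpose k l s)))"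
    using lk by (intro sum_comp_transpose_mono) auto
  moreover have "z \<circ> transpose k l \<in> assignments N I n"
    using k l' z by (intro assignments_comp_permutes permutes_swap_id) auto
  ultimately show ?thesis
    using z by (simp add: sign_score_contingency_table)
qed

text \<open>Sorted outcomes make the subjects with outcome 1 an initial segment. This identifies the
  claimed maximiser with the indicator of outcome 2.\<close>

lemma le_outcome_count_iff:
  assumes r: "r \<in> {1..N} \<rightarrow> {1, 2}" "mono_on {1..N} r" and s: "s \<in> {1..N}"
  shows "s \<le> outcome_count N r 1 \<longleftrightarrow> r s \<noteq> 2"
proof -
  let ?O = "{t \<in> {1..N}. r t = 1}"
  have r12: "r t = 1 \<or> r t = 2" if "t \<in> {1..N}" for t using r(1) that by blast
  show ?thesis
  proof (cases "r s = 2")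
    case True
    have "?O \<subseteq> {1..<s}"
    proof
      fix t assume t: "t \<in> ?O"
      then have "\<not> s \<le> t" using mono_onD[OF r(2), of s t] s True by auto
      then show "t \<in> {1..<s}" using t by auto
    qed
    \<comment> \<open>The bound is \<open>s - 1\<close>, which is strictly below \<open>s\<close>
      because \<open>s \<ge> 1\<close>.\<close>
    then have "card ?O \<le> card {1..<s}" by (intro card_mono) auto
    then show ?thesis using True s by (auto simp: outcome_count_def)
  next
    case False
    have "{1..s} \<subseteq> ?O"
    proof
      fix t assume t: "t \<in> {1..s}"
      then have "r t \<le> r s" using mono_onD[OF r(2), of t s] s by auto
      then show "t \<in> ?O" using r12[of t] r12[OF s] False s t by auto
    qed
    then have "card {1..s} \<le> card ?O" by (intro card_mono) auto
    then show ?thesis using False by (simp add: outcome_count_def)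
  qed
qed

section \<open>Comparison of the significance levels\<close>

lemma significance_le:
  assumes r: "r \<in> {1..N} \<rightarrow> {1, 2}" "mono_on {1..N} r" and w: "mono_on {1..I} w"
    and \<delta>: "\<delta> \<in> {1..I} \<rightarrow> {0, 1}" "mono_on {1..I} \<delta>" and "\<gamma> \<ge> 0"
    and u: "u \<in> confounders N"
  shows "significance N I n \<gamma> \<delta> c (sign_score I w) r u \<le>
     significance N I n \<gamma> \<delta> c (sign_score I w) r (\<lambda>s\<in>{1..N}. if s \<le> outcome_count N r 1 then 0 else 1)"
    (is "?sig u \<le> ?sig ?v")
proof -
  define m where "m = (\<Sum>i | i \<in> {1..I} \<and> \<delta> i = 1. n i)"
  define X where "X = {D. D \<subseteq> {1..N} \<and> card D = m}"
  define S where "S = {s \<in> {1..N}. r s = 2}"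
  define T where "T z = sign_score I w (contingency_table N z r)" for z
  define F where "F D = real (card {z \<in> assignments N I n. exposed N \<delta> z = D \<and> T z \<ge> c})" for D
  \<comment> \<open>The vacuous condition makes \<open>card_assignments_exposed_mono\<close> applicable to a zero statistic.\<close>
  define K where "K D = real (card {z \<in> assignments N I n. exposed N \<delta> z = D \<and> (0::real) \<ge> 0})" for D
  define b where "b D = exp (\<gamma> * real (card (D \<inter> S)))" for D
  define \<phi> where "\<phi> D = exp (\<gamma> * (sum u D - real (card (D \<inter> S))))" for D
  have "finite X" by (simp add: X_def)
  have F: "F D \<le> F D'" if "D \<in> X" "D' \<in> X" "card (D \<inter> S) \<le> card (D' \<inter> S)" for D D'
    unfolding F_def of_nat_le_iff
    using that sign_score_comp_transpose_mono[OF w \<delta>, of _ N n _ _ r]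
    by (intro card_assignments_exposed_mono[where m = m and S = S]) (auto simp: X_def S_def T_def)
  \<comment> \<open>With \<open>S = {}\<close> all overlaps vanish, so the inequality holds in both
    directions and \<open>K\<close> is constant on \<open>X\<close>.\<close>
  have K: "K D \<le> K D'" if "D \<in> X" "D' \<in> X" for D D'
    unfolding K_def of_nat_le_iff
    using that by (intro card_assignments_exposed_mono[where m = m and S = "{}"]) (auto simp: X_def)
  have "\<exists>k\<ge>0. \<forall>D\<in>X. K D = k"
  proof (cases "X = {}")
    case False
    then obtain D where "D \<in> X" by blast
    then have "K D \<ge> 0 \<and> (\<forall>D'\<in>X. K D' = K D)"
      using K by (auto simp: K_def intro: antisym)
    then show ?thesis by blast
  qed auto
  then obtain k where k: "\<And>D. D \<in> X \<Longrightarrow> K D = k" "k \<ge> 0"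
    by blast
  have sig: "?sig v = (\<Sum>D\<in>X. F D * exp (\<gamma> * sum v D)) / (k * (\<Sum>D\<in>X. exp (\<gamma> * sum v D)))" for v
  proof -
    have "(\<Sum>D\<in>X. K D * exp (\<gamma> * sum v D)) = k * (\<Sum>D\<in>X. exp (\<gamma> * sum v D))"
      by (simp add: k(1) sum_distrib_left)
    then show ?thesis
      using sum_assignments_exposed[OF \<delta>(1), where N = N and n = n and P = "\<lambda>z. T z \<ge> c" and \<gamma> = \<gamma> and v = v]
        sum_assignments_exposed[OF \<delta>(1), where N = N and n = n and P = "\<lambda>z. (0::real) \<ge> 0" and \<gamma> = \<gamma> and v = v]
      by (simp add: significance_def F_def K_def T_def X_def m_def)
  qed
  have eu: "exp (\<gamma> * sum u D) = b D * \<phi> D" for D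
    by (simp add: b_def \<phi>_def exp_add[symmetric] algebra_simps)
  have ev: "exp (\<gamma> * sum ?v D) = b D" if "D \<in> X" for D
  proof -
    have D: "D \<subseteq> {1..N}" using that by (simp add: X_def)
    have "sum ?v D = (\<Sum>s\<in>D. if s \<in> S then 1 else 0)"
      using D le_outcome_count_iff[OF r] by (intro sum.cong) (auto simp: S_def subset_iff)
    also have "\<dots> = real (card (D \<inter> S))"
      using finite_subset[OF D] by (simp add: sum.If_cases)
    finally show ?thesis by (simp add: b_def)
  qed
  \<comment> \<open>The exchange raises the overlap by exactly 1 and the sum of \<open>u\<close> by
    \<open>u k - u l\<close>, which is at most 1.\<close>
  have \<phi>: "\<phi> (insert k (D - {l})) \<le> \<phi> D" if "D \<in> X" "l \<in> D - S" "k \<in> S - D" for D k l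
  proof -
    have D: "D \<subseteq> {1..N}" "finite D" using that finite_subset by (auto simp: X_def)
    have "u k \<le> 1" "u l \<ge> 0" using u that D by (auto simp: confounders_def S_def)
    moreover have "sum u (insert k (D - {l})) = sum u D - u l + u k"
      using that D by (simp add: sum_diff1)
    moreover have "insert k (D - {l}) \<inter> S = insert k (D \<inter> S)" using that by auto
    then have "card (insert k (D - {l}) \<inter> S) = Suc (card (D \<inter> S))"
      using that D by simp
    ultimately show ?thesis
      using \<open>\<gamma> \<ge> 0\<close> by (auto simp: \<phi>_def intro!: mult_left_mono)
  qed
  have main: "(\<Sum>D\<in>X. b D * F D * \<phi> D) * (\<Sum>D\<in>X. b D) \<le> (\<Sum>D\<in>X. b D * F D) * (\<Sum>D\<in>X. b D * \<phi> D)"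
    unfolding X_def
    by (rule overlap_association[where S = S and \<beta> = "\<lambda>x. exp (\<gamma> * real x)"])
      (use F \<phi> in \<open>auto simp: X_def b_def S_def\<close>)
  show ?thesis
  proof (cases "X = {}")
    case False
    then have pos: "(\<Sum>D\<in>X. b D) > 0" "(\<Sum>D\<in>X. b D * \<phi> D) > 0" and "k \<ge> 0"
      using \<open>finite X\<close> k(2) by (auto intro!: sum_pos simp: b_def \<phi>_def)
    have "?sig u = (\<Sum>D\<in>X. b D * F D * \<phi> D) / (\<Sum>D\<in>X. b D * \<phi> D) / k"
      by (simp add: sig eu mult_ac)
    \<comment> \<open>Only \<open>k \<ge> 0\<close> is available; if \<open>k = 0\<close>, both
      quotients are 0 by the convention for division by zero.\<close>
    also have "\<dots> \<le> (\<Sum>D\<in>X. b D * F D) / (\<Sum>D\<in>X. b D) / k"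
      using main pos \<open>k \<ge> 0\<close> by (intro divide_right_mono) (simp_all add: divide_simps)
    also have "\<dots> = ?sig ?v"
      by (simp add: sig ev mult_ac del: restrict_apply One_nat_def)
    finally show ?thesis .
  qed (simp add: sig)
qed

theorem theorem3:
  fixes N I :: nat
    and n r :: "nat \<Rightarrow> nat"
    and w \<delta> :: "nat \<Rightarrow> real"
    and \<gamma> c :: real
  assumes "\<forall>i\<in>{1..I}. n i > 0"
    and "(\<Sum>i=1..I. n i) = N"
    and "r \<in> {1..N} \<rightarrow> {1, 2}"
    and "mono_on {1..N} r"
    and "mono_on {1..I} w"
    and "\<delta> \<in> {1..I} \<rightarrow> {0, 1}"
    and "\<exists>i\<in>{1..I}. \<exists>j\<in>{1..I}. \<delta> i \<noteq> \<delta> j"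
    and "mono_on {1..I} \<delta>"
    and "\<gamma> \<ge> 0"
  shows "worst_case_confounder N I n \<gamma> \<delta> c (sign_score I w) r
           (\<lambda>s\<in>{1..N}. if s \<le> outcome_count N r 1 then 0 else 1)"
proof -
  let ?v = "\<lambda>s\<in>{1..N}. if s \<le> outcome_count N r 1 then 0 else 1 :: real"
  have "?v \<in> confounders N"
    by (auto simp: confounders_def)
  then show ?thesis
    using significance_le[OF assms(3,4,5,6,8,9)]
    by (simp add: worst_case_confounder_def is_arg_max_linorder)
qed

end
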